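(* Consider the distribution network reconfiguration (DNR) model (all constraints and variables as given in the context). At every feasible solution $\mathbf{z}$ of the DNR model, the linear independence constraint qualification (LICQ) fails for the constraints of the DNR model; that is, the gradients at $\mathbf{z}$ of all equality constraints and all active inequality constraints are not linearly independent.
   Context: Network: a power distribution network with finite set of buses $\mathcal{N}$ and finite set of lines $\mathcal{L}$; each line $ij\in\mathcal{L}$ joins buses $i,j$ and has a presupposed direction from $i$ to $j$. $\mathcal{L}_j^+$ is the set of lines $ij$ directed into bus $j$, and $\mathcal{L}_j^-$ is the set of lines $jk$ directed out of bus $j$. Real parameters: resistances $r_{ij}$, reactances $x_{ij}$, limits $P_{ij}^{\max},Q_{ij}^{\max}$ for $ij\in\mathcal{L}$, voltage limits $V_i^{\min},V_i^{\max}$ for $i\in\mathcal{N}$, and a large constant $M$. DNR model: the variable is $\mathbf{z}\in\mathbb{R}^{3|\mathcal{N}|+4|\mathcal{L}|}$ with components $p_j,q_j,v_j$ ($j\in\mathcal{N}$) and $p_{ij},q_{ij},l_{ij},u_{ij}$ ($ij\in\mathcal{L}$), all real (in particular each line state $u_{ij}$ is a real variable). Minimize $\sum_{ij\in\mathcal{L}} r_{ij}l_{ij}$ subject to - $p_j=\sum_{ij\in\mathcal{L}_j^+}(r_{ij}l_{ij}-p_{ij})+\sum_{jk\in\mathcal{L}_j^-}p_{jk}$ for all $j\in\mathcal{N}$; - $q_j=\sum_{ij\in\mathcal{L}_j^+}(x_{ij}l_{ij}-q_{ij})+\sum_{jk\in\mathcal{L}_j^-}q_{jk}$ for all $j\in\mathcal{N}$;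 - $v_i-v_j\ge 2(r_{ij}p_{ij}+x_{ij}q_{ij})-(r_{ij}^2+x_{ij}^2)l_{ij}-M(1-u_{ij})$ for all $ij\in\mathcal{L}$; - $v_i-v_j\le 2(r_{ij}p_{ij}+x_{ij}q_{ij})-(r_{ij}^2+x_{ij}^2)l_{ij}+M(1-u_{ij})$ for all $ij\in\mathcal{L}$; - $v_il_{ij}=p_{ij}^2+q_{ij}^2$ for all $ij\in\mathcal{L}$; - $-u_{ij}P_{ij}^{\max}\le p_{ij}\le u_{ij}P_{ij}^{\max}$ for all $ij\in\mathcal{L}$; - $-u_{ij}Q_{ij}^{\max}\le q_{ij}\le u_{ij}Q_{ij}^{\max}$ for all $ij\in\mathcal{L}$; - $(V_i^{\min})^2\le v_i\le (V_i^{\max})^2$ for all $i\in\mathcal{N}$; - $u_{ij}(u_{ij}-1)=0$ for all $ij\in\mathcal{L}$; - $\sum_{ij\in\mathcal{L}_j^+}u_{ij}+\sum_{jk\in\mathcal{L}_j^-}u_{jk}\ge 1$ for all $j\in\mathcal{N}$; - $\sum_{j\in\mathcal{N}}\sum_{ij\in\mathcal{L}_j^+}u_{ij}=|\mathcal{N}|-1$. LICQ: writing the equality constraints as $\mathbf{g}(\mathbf{z})=\mathbf{0}$ and the inequality constraints as $\mathbf{h}(\mathbf{z})\le\mathbf{0}$ (two-sided bounds count as two scalar inequalities), the LICQ holds at a feasible $\mathbf{z}$ if the gradients at $\mathbf{z}$ of all components of $\mathbf{g}$ and of all components of $\mathbf{h}$ that vanish at $\mathbf{z}$ are linearly independent.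 *)

theory Defs
  imports "HOL-Analysis.Analysis"
begin

section \<open>Gradients and linear independence of families\<close>

definition gradient :: "('a::real_inner \<Rightarrow> real) \<Rightarrow> 'a \<Rightarrow> 'a" where
  "gradient f z = (THE D. GDERIV f z :> D)"

lemma gradient_eqI:
  assumes "GDERIV f z :> D"
  shows "gradient f z = D"
  unfolding gradient_def
proof (rule the_equality)
  fix D' assume "GDERIV f z :> D'"
  then have "(\<lambda>h. inner h D') = (\<lambda>h. inner h D)"
    using assms unfolding gderiv_def by (rule has_derivative_unique)
  then have "inner h D' = inner h D" for h
    by metis
  then show "D' = D"
    by (metis inner_commute vector_eq_rdot)
qed (fact assms)

lemma GDERIV_gradient:
  fixes f :: "'a::euclidean_space \<Rightarrow> real"
  assumes "f differentiable (at z)"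
  shows "GDERIV f z :> gradient f z"
proof -
  obtain f' where f': "(f has_derivative f') (at z)"
    using assms unfolding differentiable_def by blast
  then interpret f': bounded_linear f'
    by (rule has_derivative_bounded_linear)
  have "f' h = inner h (\<Sum>b\<in>Basis. f' b *\<^sub>R b)" for h
  proof -
    have "f' h = f' (\<Sum>b\<in>Basis. inner h b *\<^sub>R b)"
      by (simp add: euclidean_representation)
    also have "\<dots> = (\<Sum>b\<in>Basis. inner h b * f' b)"
      by (simp add: f'.sum f'.scaleR)
    finally show ?thesis
      by (simp add: inner_sum_right mult.commute)
  qed
  then have "GDERIV f z :> (\<Sum>b\<in>Basis. f' b *\<^sub>R b)"
    using f' unfolding gderiv_def by (metis (no_types, lifting) ext)
  then show ?thesis
    by (simp add: gradient_eqI)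
qed

text \<open>
  Linear independence of an indexed family: unlike independence of the image set,
  it fails when two members of the family coincide.
\<close>

definition independent_family :: "('i::finite \<Rightarrow> 'a::real_vector) \<Rightarrow> 'i set \<Rightarrow> bool" where
  "independent_family w A \<longleftrightarrow>
    (\<forall>c :: 'i \<Rightarrow> real. (\<Sum>i\<in>A. c i *\<^sub>R w i) = 0 \<longrightarrow> (\<forall>i\<in>A. c i = 0))"

lemma independent_family_iff:
  "independent_family w A \<longleftrightarrow> inj_on w A \<and> independent (w ` A)"
proof
  assume *: "independent_family w A"
  have inj: "inj_on w A"
  proof (rule inj_onI, rule ccontr)
    fix i j assume ij: "i \<in> A" "j \<in> A" "w i = w j" "i \<noteq> j"
    let ?c = "\<lambda>k. if k = i then 1 else if k = j then -1 else (0::real)"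
    have "(\<Sum>k\<in>A. ?c k *\<^sub>R w k) = (\<Sum>k\<in>{i, j}. ?c k *\<^sub>R w k)"
      using ij by (intro sum.mono_neutral_right) auto
    also have "\<dots> = 0"
      using ij by simp
    finally have "?c i = 0"
      using *[unfolded independent_family_def, THEN spec, of ?c] ij(1) by blast
    then show False by simp
  qed
  moreover have "independent (w ` A)"
  proof (subst independent_explicit_finite_subsets, intro allI impI ballI)
    fix S u v
    assume S: "S \<subseteq> w ` A" "finite S" "(\<Sum>v\<in>S. u v *\<^sub>R v) = 0" "v \<in> S"
    let ?c = "\<lambda>i. if w i \<in> S then u (w i) else (0::real)"
    have "(\<Sum>i\<in>A. ?c i *\<^sub>R w i) = (\<Sum>x\<in>w ` A. (if x \<in> S then u x else 0) *\<^sub>R x)"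
      by (simp add: sum.reindex[OF inj])
    also have "\<dots> = (\<Sum>x\<in>S. u x *\<^sub>R x)"
      using S(1) by (intro sum.mono_neutral_cong_right) auto
    finally have "\<forall>i\<in>A. ?c i = 0"
      using *[unfolded independent_family_def, THEN spec, of ?c] S(3) by simp
    then show "u v = 0"
      using S(1,4) by fastforce
  qed
  ultimately show "inj_on w A \<and> independent (w ` A)" ..
next
  assume *: "inj_on w A \<and> independent (w ` A)"
  show "independent_family w A"
    unfolding independent_family_def
  proof (intro allI impI ballI)
    fix c :: "'a \<Rightarrow> real" and i
    assume c: "(\<Sum>i\<in>A. c i *\<^sub>R w i) = 0" and i: "i \<in> A"
    have "(\<Sum>x\<in>w ` A. c (the_inv_into A w x) *\<^sub>R x) = (\<Sum>i\<in>A. c i *\<^sub>R w i)"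
      using * by (simp add: sum.reindex the_inv_into_f_f)
    then have "c (the_inv_into A w (w i)) = 0"
      using * c i independentD[of "w ` A" "w ` A" "\<lambda>x. c (the_inv_into A w x)" "w i"] by simp
    then show "c i = 0"
      using * i by (simp add: the_inv_into_f_f)
  qed
qed

definition LICQ ::
  "('e::finite \<Rightarrow> 'a::real_inner \<Rightarrow> real) \<Rightarrow> ('i::finite \<Rightarrow> 'a \<Rightarrow> real) \<Rightarrow> 'a \<Rightarrow> bool" where
  "LICQ g h z \<longleftrightarrow>
    independent_family (case_sum (\<lambda>e. gradient (g e) z) (\<lambda>i. gradient (h i) z))
      (UNIV <+> {i. h i z = 0})"


section \<open>The distribution network reconfiguration model\<close>

text \<open>
  Buses and lines are the elements of two finite types; line l is directed from
  bus source N l to bus target N l.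
\<close>

record ('n, 'l) network =
  source :: "'l \<Rightarrow> 'n"
  target :: "'l \<Rightarrow> 'n"
  res :: "'l \<Rightarrow> real"
  react :: "'l \<Rightarrow> real"
  Pmax :: "'l \<Rightarrow> real"
  Qmax :: "'l \<Rightarrow> real"
  Vmin :: "'n \<Rightarrow> real"
  Vmax :: "'n \<Rightarrow> real"
  bigM :: real

definition lines_in :: "('n, 'l) network \<Rightarrow> 'n \<Rightarrow> 'l set" where
  "lines_in N j = {l. target N l = j}"

definition lines_out :: "('n, 'l) network \<Rightarrow> 'n \<Rightarrow> 'l set" where
  "lines_out N j = {l. source N l = j}"

text \<open>
  Coordinates of the decision vector: power injections and squared voltage at the buses;
  power flows, squared current and switch state of the lines.
\<close>

datatype ('n, 'l) coord = PB 'n | QB 'n | VB 'n | PL 'l | QL 'l | LL 'l | UL 'l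

lemma UNIV_coord:
  "(UNIV :: ('n, 'l) coord set) =
    range PB \<union> range QB \<union> range VB \<union> range PL \<union> range QL \<union> range LL \<union> range UL"
proof -
  have "x \<in> range PB \<union> range QB \<union> range VB \<union> range PL \<union> range QL \<union> range LL \<union> range UL"
    for x :: "('n, 'l) coord"
    by (cases x) auto
  then show ?thesis by blast
qed

instance coord :: (finite, finite) finite
  by standard (simp add: UNIV_coord)

lemma CARD_coord:
  "CARD(('n::finite, 'l::finite) coord) = 3 * CARD('n) + 4 * CARD('l)"
  unfolding UNIV_coord
  by (subst card_Un_disjoint; auto simp: card_image inj_def)+

definition dnr_feasible ::
  "('n::finite, 'l::finite) network \<Rightarrow> real ^ ('n, 'l) coord \<Rightarrow> bool" where
  "dnr_feasible N z \<longleftrightarrow>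
    (\<forall>j. z $ PB j = (\<Sum>l\<in>lines_in N j. res N l * z $ LL l - z $ PL l)
                    + (\<Sum>l\<in>lines_out N j. z $ PL l)) \<and>
    (\<forall>j. z $ QB j = (\<Sum>l\<in>lines_in N j. react N l * z $ LL l - z $ QL l)
                    + (\<Sum>l\<in>lines_out N j. z $ QL l)) \<and>
    (\<forall>l. z $ VB (source N l) - z $ VB (target N l)
           \<ge> 2 * (res N l * z $ PL l + react N l * z $ QL l)
              - ((res N l)\<^sup>2 + (react N l)\<^sup>2) * z $ LL l - bigM N * (1 - z $ UL l)) \<and>
    (\<forall>l. z $ VB (source N l) - z $ VB (target N l)
           \<le> 2 * (res N l * z $ PL l + react N l * z $ QL l)
              - ((res N l)\<^sup>2 + (react N l)\<^sup>2) * z $ LL l + bigM N * (1 - z $ UL l)) \<and>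
    (\<forall>l. z $ VB (source N l) * z $ LL l = (z $ PL l)\<^sup>2 + (z $ QL l)\<^sup>2) \<and>
    (\<forall>l. - z $ UL l * Pmax N l \<le> z $ PL l \<and> z $ PL l \<le> z $ UL l * Pmax N l) \<and>
    (\<forall>l. - z $ UL l * Qmax N l \<le> z $ QL l \<and> z $ QL l \<le> z $ UL l * Qmax N l) \<and>
    (\<forall>i. (Vmin N i)\<^sup>2 \<le> z $ VB i \<and> z $ VB i \<le> (Vmax N i)\<^sup>2) \<and>
    (\<forall>l. z $ UL l * (z $ UL l - 1) = 0) \<and>
    (\<forall>j. (\<Sum>l\<in>lines_in N j. z $ UL l) + (\<Sum>l\<in>lines_out N j. z $ UL l) \<ge> 1) \<and>
    (\<Sum>j\<in>UNIV. \<Sum>l\<in>lines_in N j. z $ UL l) = real CARD('n) - 1"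


subsection \<open>Standard form\<close>

datatype ('n, 'l) eq_con = P_balance 'n | Q_balance 'n | Flow 'l | Binary 'l | Radial

datatype ('n, 'l) ineq_con =
    V_drop_lower 'l | V_drop_upper 'l
  | P_lower 'l | P_upper 'l | Q_lower 'l | Q_upper 'l
  | V_lower 'n | V_upper 'n | Connected 'n

instance eq_con :: (finite, finite) finite
proof
  have "x \<in> range P_balance \<union> range Q_balance \<union> range Flow \<union> range Binary \<union> {Radial}"
    for x :: "('a, 'b) eq_con"
    by (cases x) auto
  then have "(UNIV :: ('a, 'b) eq_con set) \<subseteq>
      range P_balance \<union> range Q_balance \<union> range Flow \<union> range Binary \<union> {Radial}"
    by blast
  then show "finite (UNIV :: ('a, 'b) eq_con set)"
    by (rule finite_subset) simp
qed

instance ineq_con :: (finite, finite) finite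
proof
  have "x \<in> range V_drop_lower \<union> range V_drop_upper \<union> range P_lower \<union> range P_upper \<union>
      range Q_lower \<union> range Q_upper \<union> range V_lower \<union> range V_upper \<union> range Connected"
    for x :: "('a, 'b) ineq_con"
    by (cases x) auto
  then have "(UNIV :: ('a, 'b) ineq_con set) \<subseteq>
      range V_drop_lower \<union> range V_drop_upper \<union> range P_lower \<union> range P_upper \<union>
      range Q_lower \<union> range Q_upper \<union> range V_lower \<union> range V_upper \<union> range Connected"
    by blast
  then show "finite (UNIV :: ('a, 'b) ineq_con set)"
    by (rule finite_subset) simp
qed

fun dnr_eq ::
  "('n::finite, 'l::finite) network \<Rightarrow> ('n, 'l) eq_con \<Rightarrow> real ^ ('n, 'l) coord \<Rightarrow> real" where
  "dnr_eq N (P_balance j) z =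
     z $ PB j - ((\<Sum>l\<in>lines_in N j. res N l * z $ LL l - z $ PL l)
                 + (\<Sum>l\<in>lines_out N j. z $ PL l))"
| "dnr_eq N (Q_balance j) z =
     z $ QB j - ((\<Sum>l\<in>lines_in N j. react N l * z $ LL l - z $ QL l)
                 + (\<Sum>l\<in>lines_out N j. z $ QL l))"
| "dnr_eq N (Flow l) z =
     z $ VB (source N l) * z $ LL l - ((z $ PL l)\<^sup>2 + (z $ QL l)\<^sup>2)"
| "dnr_eq N (Binary l) z = z $ UL l * (z $ UL l - 1)"
| "dnr_eq N Radial z =
     (\<Sum>j\<in>UNIV. \<Sum>l\<in>lines_in N j. z $ UL l) - (real CARD('n) - 1)"

fun dnr_ineq ::
  "('n::finite, 'l::finite) network \<Rightarrow> ('n, 'l) ineq_con \<Rightarrow> real ^ ('n, 'l) coord \<Rightarrow> real" where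
  "dnr_ineq N (V_drop_lower l) z =
     (2 * (res N l * z $ PL l + react N l * z $ QL l)
        - ((res N l)\<^sup>2 + (react N l)\<^sup>2) * z $ LL l - bigM N * (1 - z $ UL l))
     - (z $ VB (source N l) - z $ VB (target N l))"
| "dnr_ineq N (V_drop_upper l) z =
     (z $ VB (source N l) - z $ VB (target N l))
     - (2 * (res N l * z $ PL l + react N l * z $ QL l)
        - ((res N l)\<^sup>2 + (react N l)\<^sup>2) * z $ LL l + bigM N * (1 - z $ UL l))"
| "dnr_ineq N (P_lower l) z = - z $ UL l * Pmax N l - z $ PL l"
| "dnr_ineq N (P_upper l) z = z $ PL l - z $ UL l * Pmax N l"
| "dnr_ineq N (Q_lower l) z = - z $ UL l * Qmax N l - z $ QL l"
| "dnr_ineq N (Q_upper l) z = z $ QL l - z $ UL l * Qmax N l"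
| "dnr_ineq N (V_lower i) z = (Vmin N i)\<^sup>2 - z $ VB i"
| "dnr_ineq N (V_upper i) z = z $ VB i - (Vmax N i)\<^sup>2"
| "dnr_ineq N (Connected j) z =
     1 - ((\<Sum>l\<in>lines_in N j. z $ UL l) + (\<Sum>l\<in>lines_out N j. z $ UL l))"

lemma all_eq_con:
  "(\<forall>e. P e) \<longleftrightarrow>
    (\<forall>j. P (P_balance j)) \<and> (\<forall>j. P (Q_balance j)) \<and> (\<forall>l. P (Flow l)) \<and>
    (\<forall>l. P (Binary l)) \<and> P Radial"
  by (metis eq_con.exhaust)

lemma all_ineq_con:
  "(\<forall>i. P i) \<longleftrightarrow>
    (\<forall>l. P (V_drop_lower l)) \<and> (\<forall>l. P (V_drop_upper l)) \<and>
    (\<forall>l. P (P_lower l)) \<and> (\<forall>l. P (P_upper l)) \<and>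
    (\<forall>l. P (Q_lower l)) \<and> (\<forall>l. P (Q_upper l)) \<and>
    (\<forall>i. P (V_lower i)) \<and> (\<forall>i. P (V_upper i)) \<and> (\<forall>j. P (Connected j))"
  by (metis ineq_con.exhaust)

lemma dnr_feasible_iff:
  "dnr_feasible N z \<longleftrightarrow> (\<forall>e. dnr_eq N e z = 0) \<and> (\<forall>i. dnr_ineq N i z \<le> 0)"
  unfolding dnr_feasible_def all_eq_con all_ineq_con dnr_eq.simps dnr_ineq.simps
    right_minus_eq diff_le_0_iff_le all_conj_distrib
  by blast

lemma differentiable_vec_nth: "(\<lambda>z. z $ k) differentiable (at (z :: real ^ 'k))"
  by (simp add: bounded_linear_vec_nth bounded_linear_imp_differentiable)

lemma differentiable_dnr_eq: "dnr_eq N e differentiable (at z)"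
  by (cases e; simp add: dnr_eq.simps[abs_def];
      intro derivative_intros differentiable_vec_nth finite ballI)

lemma differentiable_dnr_ineq: "dnr_ineq N i differentiable (at z)"
  by (cases i; simp add: dnr_ineq.simps[abs_def];
      intro derivative_intros differentiable_vec_nth finite ballI)

end

theory Submission
  imports Defs
begin

text \<open>
  The conflict is between the radiality equation and the equations that make the line states
  binary.  Every line has exactly one target bus, so the radiality equation only involves the sum
  of all line states, and its gradient is the sum of the unit vectors \<open>e\<^sub>l\<close> in the directions of the
  line states (\<open>gradient_Radial\<close>).  The gradient of \<open>u\<^sub>l (u\<^sub>l - 1)\<close> is \<open>(2 u\<^sub>l - 1) e\<^sub>l\<close>
  (\<open>gradient_Binary\<close>), and feasibility forces \<open>u\<^sub>l\<close> to be 0 or 1, so the factor is \<open>-1\<close> or \<open>1\<close> and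
  never vanishes.  The gradients of the binary equations therefore span all line-state directions,
  in particular the gradient of the radiality equation.  Equality constraints enter LICQ at every
  feasible point, so it fails everywhere.
\<close>

text \<open>
  A linear relation among the gradients of the equality constraints extends by zero to the active
  inequality constraints, whichever these are.
\<close>

lemma not_LICQ_if_eq_gradients_dependent:
  fixes g :: "'e::finite \<Rightarrow> 'a::real_inner \<Rightarrow> real" and h :: "'i::finite \<Rightarrow> 'a \<Rightarrow> real"
  assumes "(\<Sum>e\<in>UNIV. c e *\<^sub>R gradient (g e) z) = 0" and "c e0 \<noteq> 0"
  shows "\<not> LICQ g h z"
proof
  assume "LICQ g h z"
  moreover have "(\<Sum>k\<in>UNIV <+> {i. h i z = 0}. case_sum c (\<lambda>_. 0) k *\<^sub>R
      case_sum (\<lambda>e. gradient (g e) z) (\<lambda>i. gradient (h i) z) k) = 0"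
    using assms(1) by (simp add: sum.Plus)
  ultimately have "\<forall>k\<in>UNIV <+> {i. h i z = 0}. case_sum c (\<lambda>_. 0) k = 0"
    unfolding LICQ_def independent_family_def by blast
  then have "case_sum c (\<lambda>_. 0) (Inl e0 :: 'e + 'i) = 0"
    by blast
  with assms(2) show False by simp
qed

lemma sum_lines_in: "(\<Sum>j\<in>UNIV. \<Sum>l\<in>lines_in N j. f l) = (\<Sum>l\<in>UNIV. f l)"
  for N :: "('n::finite, 'l::finite) network"
  using sum.group[of UNIV UNIV "target N" f] by (simp add: lines_in_def)

lemma gradient_Binary:
  "gradient (dnr_eq N (Binary l)) z = (2 * z $ UL l - 1) *\<^sub>R axis (UL l) 1"
proof (rule gradient_eqI)
  have "((\<lambda>z. z $ UL l * (z $ UL l - 1)) has_derivative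
      (\<lambda>h. z $ UL l * h $ UL l + h $ UL l * (z $ UL l - 1))) (at z)"
    by (auto intro!: derivative_eq_intros bounded_linear.has_derivative[OF bounded_linear_vec_nth])
  then show "GDERIV (dnr_eq N (Binary l)) z :> (2 * z $ UL l - 1) *\<^sub>R axis (UL l) 1"
    by (simp add: gderiv_def dnr_eq.simps[abs_def] inner_axis algebra_simps)
qed

lemma gradient_Radial: "gradient (dnr_eq N Radial) z = (\<Sum>l\<in>UNIV. axis (UL l) 1)"
proof (rule gradient_eqI)
  have "((\<lambda>z. (\<Sum>l\<in>UNIV. z $ UL l) - (real CARD('a) - 1)) has_derivative
      (\<lambda>h. \<Sum>l\<in>UNIV. h $ UL l)) (at z)"
    by (auto intro!: derivative_eq_intros bounded_linear.has_derivative[OF bounded_linear_vec_nth])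
  then show "GDERIV (dnr_eq N Radial) z :> (\<Sum>l\<in>UNIV. axis (UL l) 1)"
    by (simp add: gderiv_def dnr_eq.simps[abs_def] sum_lines_in inner_sum_right inner_axis)
qed

theorem lemma1:
  fixes N :: "('n::finite, 'l::finite) network"
    and z :: "real ^ ('n, 'l) coord"
  assumes "dnr_feasible N z"
  shows "\<not> LICQ (dnr_eq N) (dnr_ineq N) z"
proof -
  define c :: "('n, 'l) eq_con \<Rightarrow> real" where
    "c e = (case e of Radial \<Rightarrow> -1 | Binary l \<Rightarrow> 2 * z $ UL l - 1 | _ \<Rightarrow> 0)" for e
  \<comment> \<open>The factor \<open>2 u\<^sub>l - 1\<close> is \<open>1\<close> or \<open>-1\<close>, hence its own inverse: the multiplier that turns
    the gradient of the binary equation of \<open>l\<close> into the unit vector is that same factor.\<close>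
  have sq: "(2 * z $ UL l - 1) * (2 * z $ UL l - 1) = 1" for l
  proof -
    have "z $ UL l * (z $ UL l - 1) = 0"
      using assms by (simp add: dnr_feasible_def)
    then show ?thesis by (simp add: algebra_simps)
  qed
  have "(\<Sum>e\<in>UNIV. c e *\<^sub>R gradient (dnr_eq N e) z)
      = (\<Sum>e\<in>insert Radial (range Binary). c e *\<^sub>R gradient (dnr_eq N e) z)"
    by (intro sum.mono_neutral_right) (auto simp: c_def split: eq_con.splits)
  also have "\<dots> = - (\<Sum>l\<in>UNIV. axis (UL l) 1) + (\<Sum>l\<in>UNIV. axis (UL l) 1)"
    by (subst sum.insert)
      (auto simp: c_def gradient_Radial gradient_Binary sum.reindex inj_def sq)
  finally have "(\<Sum>e\<in>UNIV. c e *\<^sub>R gradient (dnr_eq N e) z) = 0"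
    by simp
  moreover have "c Radial \<noteq> 0"
    by (simp add: c_def)
  ultimately show ?thesis
    by (rule not_LICQ_if_eq_gradients_dependent)
qed

end
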